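(* Let $(L,[-,-],\varepsilon,\alpha_L)$ be a color Hom-Leibniz algebra and $(M,\mu_L,\mu_R,\alpha_M)$ a color Hom-Leibniz module over $L$. Then $$\tilde\mu_L=\mu_L(\alpha_L^2\otimes \mathrm{Id}_M):L\otimes M\to M,\qquad \tilde\mu_R=\mu_R(\mathrm{Id}_M\otimes\alpha_L^2):M\otimes L\to M,$$ define another color Hom-Leibniz module structure on $M$ (i.e. $(M,\tilde\mu_L,\tilde\mu_R,\alpha_M)$ is again a color Hom-Leibniz module over $L$).
   Context: $\mathbf K$ is a field of characteristic $0$ and $G$ is an abelian group (written additively). A linear (or bilinear) map between $G$-graded vector spaces is even if it preserves degrees. A bicharacter is a map $\varepsilon:G\times G\to\mathbf K^*$ with $\varepsilon(a,b)\varepsilon(b,a)=1$, $\varepsilon(a,b+c)=\varepsilon(a,b)\varepsilon(a,c)$, $\varepsilon(a+b,c)=\varepsilon(a,c)\varepsilon(b,c)$ for all $a,b,c\in G$. For homogeneous $u,v$ of degrees $a,b$ one writes $\varepsilon(u,v):=\varepsilon(a,b)$. A (left) color Hom-Leibniz algebra is a quadruple $(L,[-,-],\varepsilon,\alpha_L)$ consisting of a $G$-graded vector space $L$, an even bilinear map $[-,-]:L\otimes L\to L$, a bicharacter $\varepsilon$ and an even linear map $\alpha_L:L\to L$ such that for all homogeneous $x,y,z\in L$ $$[\alpha_L(x),[y,z]]=[[x,y],\alpha_L(z)]+\varepsilon(x,y)[\alpha_L(y),[x,z]].$$ A Hom-module is a pair $(M,\alpha_M)$ with $M$ a $G$-graded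 vector space and $\alpha_M:M\to M$ an even linear map. A color Hom-Leibniz module over $L$ (an $L$-module) $(M,\mu_L,\mu_R,\alpha_M)$ is a Hom-module $(M,\alpha_M)$ with even bilinear maps $\mu_L:L\otimes M\to M$, $\mu_L(x\otimes m)=x\cdot m$, and $\mu_R:M\otimes L\to M$, $\mu_R(m\otimes x)=m\ast x$, such that for all homogeneous $x,y\in L$ and $m\in M$: $$\alpha_M(x\cdot m)=\alpha_L(x)\cdot\alpha_M(m),\qquad \alpha_M(m\ast x)=\alpha_M(m)\ast\alpha_L(x),$$ $$[x,y]\cdot\alpha_M(m)=\alpha_L(x)\cdot(y\cdot m)-\varepsilon(x,y)\,\alpha_L(y)\cdot(x\cdot m),$$ $$\alpha_M(m)\ast[x,y]=(x\cdot m)\ast\alpha_L(y)+\varepsilon(x,m)\,\alpha_L(x)\cdot(m\ast y),$$ $$\alpha_L(x)\cdot(m\ast y)=(x\cdot m)\ast\alpha_L(y)+\varepsilon(m,x)\,\alpha_M(m)\ast[x,y].$$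
   Formalization: The formal theorem additionally assumes that α_L is multiplicative, α_L[x,y]=[α_L x,α_L y]; without this the statement fails, since α_L²[x,y] need not act on α_M(M) as [α_L²x,α_L²y] does. *)

theory Defs
  imports Complex_Main
begin

locale graded_vector_space = vector_space scale
  for scale :: "'k::field_char_0 \<Rightarrow> 'v::ab_group_add \<Rightarrow> 'v" +
  fixes comp :: "'g::ab_group_add \<Rightarrow> 'v set"
  assumes subspace_comp: "subspace (comp a)"
    and direct_sum: "\<exists>!f. finite {a. f a \<noteq> 0} \<and> (\<forall>a. f a \<in> comp a) \<and> v = (\<Sum>a | f a \<noteq> 0. f a)"

definition even_linear ::
  "('k::field \<Rightarrow> 'v::ab_group_add \<Rightarrow> 'v) \<Rightarrow> ('g \<Rightarrow> 'v set) \<Rightarrow>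
   ('k \<Rightarrow> 'w::ab_group_add \<Rightarrow> 'w) \<Rightarrow> ('g \<Rightarrow> 'w set) \<Rightarrow> ('v \<Rightarrow> 'w) \<Rightarrow> bool" where
  "even_linear sV V sW W f \<longleftrightarrow>
     Vector_Spaces.linear sV sW f \<and> (\<forall>a. \<forall>v\<in>V a. f v \<in> W a)"

text \<open>Linear maps out of a tensor product are rendered as curried bilinear maps; the tensor
  product of homogeneous elements of degrees \<open>a\<close> and \<open>b\<close> has degree \<open>a + b\<close>.\<close>

definition even_bilinear ::
  "('k::field \<Rightarrow> 'u::ab_group_add \<Rightarrow> 'u) \<Rightarrow> ('g::ab_group_add \<Rightarrow> 'u set) \<Rightarrow>
   ('k \<Rightarrow> 'v::ab_group_add \<Rightarrow> 'v) \<Rightarrow> ('g \<Rightarrow> 'v set) \<Rightarrow>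
   ('k \<Rightarrow> 'w::ab_group_add \<Rightarrow> 'w) \<Rightarrow> ('g \<Rightarrow> 'w set) \<Rightarrow> ('u \<Rightarrow> 'v \<Rightarrow> 'w) \<Rightarrow> bool" where
  "even_bilinear sU U sV V sW W f \<longleftrightarrow>
     (\<forall>u. Vector_Spaces.linear sV sW (f u)) \<and>
     (\<forall>v. Vector_Spaces.linear sU sW (\<lambda>u. f u v)) \<and>
     (\<forall>a b. \<forall>u\<in>U a. \<forall>v\<in>V b. f u v \<in> W (a + b))"

locale bicharacter =
  fixes eps :: "'g::ab_group_add \<Rightarrow> 'g \<Rightarrow> 'k::field_char_0"
  assumes nonzero: "eps a b \<noteq> 0"
    and skew: "eps a b * eps b a = 1"
    and add_right: "eps a (b + c) = eps a b * eps a c"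
    and add_left: "eps (a + b) c = eps a c * eps b c"

text \<open>\<open>eps\<close> takes degrees as arguments, so each identity for homogeneous elements is quantified
  over the elements together with degrees they belong to.\<close>

locale color_hom_leibniz_algebra =
  L: graded_vector_space scaleL L + bicharacter eps
  for scaleL :: "'k::field_char_0 \<Rightarrow> 'l::ab_group_add \<Rightarrow> 'l"
    and L :: "'g::ab_group_add \<Rightarrow> 'l set"
    and bracket :: "'l \<Rightarrow> 'l \<Rightarrow> 'l"
    and eps :: "'g \<Rightarrow> 'g \<Rightarrow> 'k"
    and alphaL :: "'l \<Rightarrow> 'l" +
  assumes bracket_even: "even_bilinear scaleL L scaleL L scaleL L bracket"
    and alphaL_even: "even_linear scaleL L scaleL L alphaL"
    and hom_leibniz: "\<lbrakk>x \<in> L a; y \<in> L b; z \<in> L c\<rbrakk> \<Longrightarrow>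
      bracket (alphaL x) (bracket y z) =
        bracket (bracket x y) (alphaL z) + scaleL (eps a b) (bracket (alphaL y) (bracket x z))"

locale color_hom_module = M: graded_vector_space scaleM M
  for scaleM :: "'k::field_char_0 \<Rightarrow> 'm::ab_group_add \<Rightarrow> 'm"
    and M :: "'g::ab_group_add \<Rightarrow> 'm set"
    and alphaM :: "'m \<Rightarrow> 'm" +
  assumes alphaM_even: "even_linear scaleM M scaleM M alphaM"

locale color_hom_leibniz_module =
  color_hom_leibniz_algebra scaleL L bracket eps alphaL + color_hom_module scaleM M alphaM
  for scaleL :: "'k::field_char_0 \<Rightarrow> 'l::ab_group_add \<Rightarrow> 'l"
    and L :: "'g::ab_group_add \<Rightarrow> 'l set"
    and bracket :: "'l \<Rightarrow> 'l \<Rightarrow> 'l"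
    and eps :: "'g \<Rightarrow> 'g \<Rightarrow> 'k"
    and alphaL :: "'l \<Rightarrow> 'l"
    and scaleM :: "'k \<Rightarrow> 'm::ab_group_add \<Rightarrow> 'm"
    and M :: "'g \<Rightarrow> 'm set"
    and muL :: "'l \<Rightarrow> 'm \<Rightarrow> 'm"
    and muR :: "'m \<Rightarrow> 'l \<Rightarrow> 'm"
    and alphaM :: "'m \<Rightarrow> 'm" +
  assumes muL_even: "even_bilinear scaleL L scaleM M scaleM M muL"
    and muR_even: "even_bilinear scaleM M scaleL L scaleM M muR"
    and alphaM_muL: "\<lbrakk>x \<in> L a; m \<in> M c\<rbrakk> \<Longrightarrow> alphaM (muL x m) = muL (alphaL x) (alphaM m)"
    and alphaM_muR: "\<lbrakk>x \<in> L a; m \<in> M c\<rbrakk> \<Longrightarrow> alphaM (muR m x) = muR (alphaM m) (alphaL x)"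
    and bracket_muL: "\<lbrakk>x \<in> L a; y \<in> L b; m \<in> M c\<rbrakk> \<Longrightarrow>
      muL (bracket x y) (alphaM m) =
        muL (alphaL x) (muL y m) - scaleM (eps a b) (muL (alphaL y) (muL x m))"
    and muR_bracket: "\<lbrakk>x \<in> L a; y \<in> L b; m \<in> M c\<rbrakk> \<Longrightarrow>
      muR (alphaM m) (bracket x y) =
        muR (muL x m) (alphaL y) + scaleM (eps a c) (muL (alphaL x) (muR m y))"
    and muL_muR: "\<lbrakk>x \<in> L a; y \<in> L b; m \<in> M c\<rbrakk> \<Longrightarrow>
      muL (alphaL x) (muR m y) =
        muR (muL x m) (alphaL y) + scaleM (eps c a) (muR (alphaM m) (bracket x y))"

text \<open>Multiplicativity of the twisting map is not part of the definition of a color Hom-Leibniz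
  algebra. It cannot be dropped when the actions are twisted by \<open>\<alpha>\<^sub>L\<^sup>2\<close>, since \<open>\<alpha>\<^sub>L\<^sup>2[x,y]\<close> has to
  act on \<open>\<alpha>\<^sub>M(M)\<close> as \<open>[\<alpha>\<^sub>L\<^sup>2 x, \<alpha>\<^sub>L\<^sup>2 y]\<close> does. Counterexample, everything in degree \<open>0\<close>: let \<open>L\<close>
  have basis \<open>x, y, z, w, u\<close> with only nonzero bracket \<open>[x,y] = z\<close> and \<open>\<alpha>\<^sub>L\<close> mapping
  \<open>z \<mapsto> w \<mapsto> u\<close> and \<open>x, y, u\<close> to \<open>0\<close>; let \<open>M\<close> have basis \<open>m, n, p, q\<close> with \<open>\<alpha>\<^sub>M\<close> mapping
  \<open>m \<mapsto> n\<close>, \<open>p \<mapsto> q\<close> and \<open>n, q\<close> to \<open>0\<close>, zero right action, and only nonzero left actions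
  \<open>w \<cdot> m = p\<close> and \<open>u \<cdot> n = q\<close>. Then \<open>\<alpha>\<^sub>L\<^sup>2[x,y] \<cdot> \<alpha>\<^sub>M(m) = q\<close>, although \<open>\<alpha>\<^sub>L x = \<alpha>\<^sub>L y = 0\<close>.\<close>

definition multiplicative :: "('l \<Rightarrow> 'l \<Rightarrow> 'l) \<Rightarrow> ('l \<Rightarrow> 'l) \<Rightarrow> bool" where
  "multiplicative bracket alpha \<longleftrightarrow> (\<forall>x y. alpha (bracket x y) = bracket (alpha x) (alpha y))"

end

theory Submission
  imports Defs
begin

text \<open>The module axioms survive precomposition of both actions with any even linear map \<open>\<beta>\<close> that
  is multiplicative and commutes with \<open>\<alpha>\<^sub>L\<close>: each axiom for the twisted actions at \<open>x, y\<close> is the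
  original one at \<open>\<beta> x, \<beta> y\<close>. The theorem is the case \<open>\<beta> = \<alpha>\<^sub>L\<^sup>2\<close>.\<close>

lemma even_linear_compose:
  assumes "even_linear sU U sV V f" and "even_linear sV V sW W g"
  shows "even_linear sU U sW W (g \<circ> f)"
  using assms unfolding even_linear_def by (auto intro: Vector_Spaces.linear_compose)

lemma even_bilinear_compose_left:
  assumes "even_linear sT T sU U h" and "even_bilinear sU U sV V sW W f"
  shows "even_bilinear sT T sV V sW W (\<lambda>t v. f (h t) v)"
  \<comment> \<open>For each fixed \<open>v\<close>, the twisted map in its first argument is the
    composite of \<open>h\<close> with the slice \<open>\<lambda>u. f u v\<close>; the other slot
    only specialises \<open>f\<close> at \<open>h t\<close>.\<close>
  using assms Vector_Spaces.linear_compose[of sT sU h sW "\<lambda>u. f u v" for v]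
  unfolding even_linear_def even_bilinear_def by (auto simp: o_def)

lemma even_bilinear_compose_right:
  assumes "even_linear sT T sV V h" and "even_bilinear sU U sV V sW W f"
  shows "even_bilinear sU U sT T sW W (\<lambda>u t. f u (h t))"
  using assms Vector_Spaces.linear_compose[of sT sV h sW "f u" for u]
  unfolding even_linear_def even_bilinear_def by (auto simp: o_def)

lemma (in color_hom_leibniz_module) twisted_module:
  assumes even: "even_linear scaleL L scaleL L \<beta>"
    and mult: "multiplicative bracket \<beta>"
    and comm: "\<And>x. \<beta> (alphaL x) = alphaL (\<beta> x)"
  shows "color_hom_leibniz_module scaleL L bracket eps alphaL scaleM M
           (\<lambda>x m. muL (\<beta> x) m) (\<lambda>m x. muR m (\<beta> x)) alphaM"
\<comment> \<open>The axioms on \<open>L\<close> and on \<open>alphaM\<close> do not mention the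
  actions and hold in the context; two evenness conditions and five identities remain.\<close>
proof unfold_locales
  \<comment> \<open>Since \<open>\<beta>\<close> keeps degrees, the factors \<open>eps a b\<close>,
    \<open>eps a c\<close> and \<open>eps c a\<close> are the same for \<open>\<beta> x\<close>,
    \<open>\<beta> y\<close> as for \<open>x\<close>, \<open>y\<close>.\<close>
  have deg: "\<beta> x \<in> L a" if "x \<in> L a" for x a
    using even that by (simp add: even_linear_def)
  have brk: "\<beta> (bracket x y) = bracket (\<beta> x) (\<beta> y)" for x y
    using mult by (simp add: multiplicative_def)
  show "even_bilinear scaleL L scaleM M scaleM M (\<lambda>x m. muL (\<beta> x) m)"
    by (rule even_bilinear_compose_left[OF even muL_even])
  show "even_bilinear scaleM M scaleL L scaleM M (\<lambda>m x. muR m (\<beta> x))"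
    by (rule even_bilinear_compose_right[OF even muR_even])
  fix x y m a b c
  assume x: "x \<in> L a" and m: "m \<in> M c"
  show "alphaM (muL (\<beta> x) m) = muL (\<beta> (alphaL x)) (alphaM m)"
    \<comment> \<open>The twisted axiom acts by \<open>\<beta> (alphaL x)\<close>, the original one
      at \<open>\<beta> x\<close> by \<open>alphaL (\<beta> x)\<close>.\<close>
    unfolding comm by (rule alphaM_muL[OF deg[OF x] m])
  show "alphaM (muR m (\<beta> x)) = muR (alphaM m) (\<beta> (alphaL x))"
    unfolding comm by (rule alphaM_muR[OF deg[OF x] m])
  assume y: "y \<in> L b"
  show "muL (\<beta> (bracket x y)) (alphaM m) =
      muL (\<beta> (alphaL x)) (muL (\<beta> y) m) - scaleM (eps a b) (muL (\<beta> (alphaL y)) (muL (\<beta> x) m))"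
    \<comment> \<open>Here a bracket acts: \<open>brk\<close> turns its image under
      \<open>\<beta>\<close> into the bracket of \<open>\<beta> x\<close> and
      \<open>\<beta> y\<close>, as the original axiom requires. The two mixed axioms below go the
      same way.\<close>
    unfolding comm brk by (rule bracket_muL[OF deg[OF x] deg[OF y] m])
  show "muR (alphaM m) (\<beta> (bracket x y)) =
      muR (muL (\<beta> x) m) (\<beta> (alphaL y)) + scaleM (eps a c) (muL (\<beta> (alphaL x)) (muR m (\<beta> y)))"
    unfolding comm brk by (rule muR_bracket[OF deg[OF x] deg[OF y] m])
  show "muL (\<beta> (alphaL x)) (muR m (\<beta> y)) =
      muR (muL (\<beta> x) m) (\<beta> (alphaL y)) + scaleM (eps c a) (muR (alphaM m) (\<beta> (bracket x y)))"
    unfolding comm brk by (rule muL_muR[OF deg[OF x] deg[OF y] m])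
qed

theorem theorem5p1:
  fixes scaleL :: "'k::field_char_0 \<Rightarrow> 'l::ab_group_add \<Rightarrow> 'l"
    and scaleM :: "'k \<Rightarrow> 'm::ab_group_add \<Rightarrow> 'm"
    and L :: "'g::ab_group_add \<Rightarrow> 'l set"
    and M :: "'g \<Rightarrow> 'm set"
    and bracket :: "'l \<Rightarrow> 'l \<Rightarrow> 'l"
    and eps :: "'g \<Rightarrow> 'g \<Rightarrow> 'k"
    and alphaL :: "'l \<Rightarrow> 'l"
    and muL :: "'l \<Rightarrow> 'm \<Rightarrow> 'm"
    and muR :: "'m \<Rightarrow> 'l \<Rightarrow> 'm"
    and alphaM :: "'m \<Rightarrow> 'm"
  assumes "color_hom_leibniz_algebra scaleL L bracket eps alphaL"
    and "multiplicative bracket alphaL"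
    and "color_hom_leibniz_module scaleL L bracket eps alphaL scaleM M muL muR alphaM"
  shows "color_hom_leibniz_module scaleL L bracket eps alphaL scaleM M
           (\<lambda>x m. muL ((alphaL ^^ 2) x) m) (\<lambda>m x. muR m ((alphaL ^^ 2) x)) alphaM"
proof -
  interpret color_hom_leibniz_module scaleL L bracket eps alphaL scaleM M muL muR alphaM
    by (rule assms(3))
  have sq: "alphaL ^^ 2 = alphaL \<circ> alphaL"
    by (simp add: numeral_2_eq_2)
  show ?thesis
  proof (rule twisted_module)
    show "even_linear scaleL L scaleL L (alphaL ^^ 2)"
      unfolding sq by (rule even_linear_compose[OF alphaL_even alphaL_even])
    show "multiplicative bracket (alphaL ^^ 2)"
      \<comment> \<open>Multiplicativity of \<open>alphaL\<close> is applied twice, once for each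
        factor of the square.\<close>
      using assms(2) by (simp add: sq multiplicative_def)
    show "(alphaL ^^ 2) (alphaL x) = alphaL ((alphaL ^^ 2) x)" for x
      by (simp add: sq)
  qed
qed

end
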